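(* Let $G=(V,E)$ be a finite simple graph with at least one edge, and consider eigenpairs of problem (M). (a) Every eigenvalue $\mu$ satisfies $0\le\mu\le 1$. (b) Any two distinct eigenvalues differ by at least $\frac{2}{\mathrm{vol}(V)}$; consequently (M) has at most $\frac{\mathrm{vol}(V)}{2}+1$ distinct eigenvalues. (c) For every $A\subseteq V$, with $\vec x=\vec 1_A-\vec 1_{V\setminus A}$ and $\mu=\frac{2|\partial A|}{\mathrm{vol}(V)}$, $(\mu,\vec x)$ is an eigenpair. (d) If $(\mu,\vec x)$ is an eigenpair, then $\frac{I(\vec x)}{\mathrm{vol}(V)\|\vec x\|_\infty}=\mu$ and $\frac{\mu}{2}=\frac{|\partial D_-(\vec x)|}{\mathrm{vol}(V)}=\frac{|\partial D_+(\vec x)|}{\mathrm{vol}(V)}$; moreover both $(\mu,\vec 1_{D_+(\vec x)}-\vec 1_{D_-(\vec x)})$ and $(\mu,\vec 1_{D_+(\vec x)}-\vec 1_{V\setminus D_+(\vec x)})$ are eigenpairs.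
   Context: $V=\{1,\dots,n\}$, unit edge weights, $d_i$ degree, $\mathrm{vol}(S)=\sum_{i\in S}d_i$, $|\partial A|$ the number of edges between $A$ and $V\setminus A$, $\vec 1_S$ indicator vector. $I(\vec x)=\sum_{\{i,j\}\in E}|x_i-x_j|$. $\mathrm{Sgn}(t)=\{1\},[-1,1],\{-1\}$ for $t>0,t=0,t<0$; $(\Delta_1\vec x)_i=\{\sum_{j:\{i,j\}\in E}z_{ij}: z_{ij}\in\mathrm{Sgn}(x_i-x_j), z_{ij}=-z_{ji}\}$. Problem (M): $(\mu,\vec x)$ is an eigenpair if $\mu\in\mathbb{R}$, $\vec x\ne\vec0$ and $\Delta_1\vec x\cap\mu\,\mathrm{vol}(V)\,\partial\|\vec x\|_\infty\neq\emptyset$, where $\partial\|\vec x\|_\infty$ is the convex subdifferential of the $\ell^\infty$ norm. $D_\pm(\vec x)=\{i:\pm x_i=\|\vec x\|_\infty\}$. *)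

theory Defs
  imports "HOL-Analysis.Analysis"
begin

text \<open>The vertex set is the whole (finite) type \<open>'v\<close>, playing the role of \<open>{1,\<dots>,n}\<close> with
  \<open>n = CARD('v)\<close>, so vectors on the vertices have type \<open>real ^ 'v\<close>. A graph is given by its set
  \<open>E\<close> of undirected edges \<open>{i, j}\<close>. The maximum norm of \<open>x\<close> is the library's \<open>infnorm x\<close>.\<close>

definition simple_graph :: "'v set set \<Rightarrow> bool" where
  "simple_graph E \<longleftrightarrow> (\<forall>e\<in>E. card e = 2)"

definition neighbours :: "'v set set \<Rightarrow> 'v \<Rightarrow> 'v set" where
  "neighbours E i = {j. {i, j} \<in> E}"

definition degree :: "'v::finite set set \<Rightarrow> 'v \<Rightarrow> nat" where
  "degree E i = card (neighbours E i)"

definition vol :: "'v::finite set set \<Rightarrow> 'v set \<Rightarrow> nat" where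
  "vol E S = (\<Sum>i\<in>S. degree E i)"

definition edge_boundary :: "'v set set \<Rightarrow> 'v set \<Rightarrow> 'v set set" where
  "edge_boundary E A = {e \<in> E. \<exists>i\<in>A. \<exists>j\<in>-A. e = {i, j}}"

definition indicator_vec :: "'v::finite set \<Rightarrow> real ^ 'v" where
  "indicator_vec S = (\<chi> i. indicat_real S i)"

text \<open>The difference \<open>\<bar>x\<^sub>i - x\<^sub>j\<bar>\<close> depends only on the unordered pair \<open>e = {i, j}\<close>, so the
  description below is unique, as the lemma confirms.\<close>

definition edge_diff :: "real ^ 'v::finite \<Rightarrow> 'v set \<Rightarrow> real" where
  "edge_diff x e = (THE d. \<exists>i j. e = {i, j} \<and> d = \<bar>x $ i - x $ j\<bar>)"

lemma edge_diff_insert [simp]: "edge_diff x {i, j} = \<bar>x $ i - x $ j\<bar>"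
  unfolding edge_diff_def
  by (rule the_equality) (auto simp: doubleton_eq_iff abs_minus_commute)

definition total_variation :: "'v::finite set set \<Rightarrow> real ^ 'v \<Rightarrow> real" where
  "total_variation E x = (\<Sum>e\<in>E. edge_diff x e)"

definition Sgn :: "real \<Rightarrow> real set" where
  "Sgn t = (if t > 0 then {1} else if t = 0 then {-1..1} else {-1})"

text \<open>The antisymmetry condition couples the components, so the set-valued 1-Laplacian is a set of
  vectors: one family \<open>z\<close> serves all coordinates at once.\<close>

definition one_laplacian :: "'v::finite set set \<Rightarrow> real ^ 'v \<Rightarrow> (real ^ 'v) set" where
  "one_laplacian E x =
     {(\<chi> i. \<Sum>j\<in>neighbours E i. z i j) | z.
        \<forall>i j. {i, j} \<in> E \<longrightarrow> z i j \<in> Sgn (x $ i - x $ j) \<and> z i j = - z j i}"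

definition subdifferential :: "('a::real_inner \<Rightarrow> real) \<Rightarrow> 'a \<Rightarrow> 'a set" where
  "subdifferential f x = {g. \<forall>y. f y \<ge> f x + g \<bullet> (y - x)}"

definition eigenpair :: "'v::finite set set \<Rightarrow> real \<Rightarrow> real ^ 'v \<Rightarrow> bool" where
  "eigenpair E \<mu> x \<longleftrightarrow> x \<noteq> 0 \<and>
     one_laplacian E x \<inter> (\<lambda>v. (\<mu> * real (vol E UNIV)) *\<^sub>R v) ` subdifferential infnorm x \<noteq> {}"

definition eigenvalue :: "'v::finite set set \<Rightarrow> real \<Rightarrow> bool" where
  "eigenvalue E \<mu> \<longleftrightarrow> (\<exists>x. eigenpair E \<mu> x)"

definition D_plus :: "real ^ 'v::finite \<Rightarrow> 'v set" where
  "D_plus x = {i. x $ i = infnorm x}"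

definition D_minus :: "real ^ 'v::finite \<Rightarrow> 'v set" where
  "D_minus x = {i. - (x $ i) = infnorm x}"

end

theory Submission
  imports Defs
begin

text \<open>At \<open>x \<noteq> 0\<close> a subgradient of the maximum norm has \<open>\<ell>\<^sup>1\<close>-norm 1 and is supported on
  \<open>D\<^sub>+ \<union> D\<^sub>-\<close>, with the sign of \<open>x\<close> there. Pairing the eigenvalue equation with \<open>x\<close>
  gives \<open>I(x) = \<mu> vol(V) \<parallel>x\<parallel>\<close>. Summing it over \<open>D\<^sub>+\<close>, the antisymmetric edge variables
  \<open>z\<close> cancel inside \<open>D\<^sub>+\<close> and equal 1 on edges leaving it, so the sum is \<open>|\<partial>D\<^sub>+|\<close>;
  likewise it is \<open>-|\<partial>D\<^sub>-|\<close> over \<open>D\<^sub>-\<close> and 0 over \<open>V\<close>. Hence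
  \<open>|\<partial>D\<^sub>+| = |\<partial>D\<^sub>-| = \<mu> vol(V) / 2\<close>, which makes the eigenvalues integer multiples of
  \<open>2 / vol(V)\<close>. The same \<open>z\<close> and the same subgradient witness the eigenpairs derived from
  \<open>D\<^sub>+\<close> and \<open>D\<^sub>-\<close>.\<close>

section \<open>The maximum norm and its subdifferential\<close>

lemma infnorm_attained:
  fixes x :: "real ^ 'n::finite"
  obtains i where "\<bar>x $ i\<bar> = infnorm x"
proof -
  have "infnorm x = Max (range (\<lambda>i. \<bar>x $ i\<bar>))"
    by (simp add: infnorm_cart full_SetCompr_eq cSup_eq_Max)
  moreover have "Max (range (\<lambda>i. \<bar>x $ i\<bar>)) \<in> range (\<lambda>i. \<bar>x $ i\<bar>)"
    by (rule Max_in) auto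
  ultimately show thesis using that by (metis imageE)
qed

lemma infnorm_eq_1I:
  fixes x :: "real ^ 'n::finite"
  assumes "\<And>i. \<bar>x $ i\<bar> \<le> 1" and "\<bar>x $ k\<bar> = 1"
  shows "infnorm x = 1"
proof -
  obtain i where "\<bar>x $ i\<bar> = infnorm x" by (rule infnorm_attained)
  then show ?thesis
    using assms component_le_infnorm_cart[of x k] by (metis order_antisym)
qed

text \<open>The norm is positively homogeneous, so its subgradients are the \<open>g\<close> of dual
  norm at most 1 with \<open>g \<bullet> x = infnorm x\<close>. The dual norm is the l1 norm, and
  equality in Hoelder's inequality must then hold term by term. For \<open>x \<noteq> 0\<close> it
  also forces l1 norm exactly 1.\<close>

lemma mem_subdifferential_infnorm_iff:
  fixes x g :: "real ^ 'n::finite"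
  assumes "x \<noteq> 0"
  shows "g \<in> subdifferential infnorm x \<longleftrightarrow>
    (\<Sum>i\<in>UNIV. \<bar>g $ i\<bar>) = 1 \<and> (\<forall>i. g $ i * x $ i = \<bar>g $ i\<bar> * infnorm x)"
proof -
  have pos: "infnorm x > 0"
    using assms by (simp add: infnorm_pos_lt)
  have le: "g $ i * y $ i \<le> \<bar>g $ i\<bar> * infnorm y" for y :: "real ^ 'n" and i
  proof -
    have "g $ i * y $ i \<le> \<bar>g $ i\<bar> * \<bar>y $ i\<bar>"
      by (metis abs_ge_self abs_mult)
    also have "\<dots> \<le> \<bar>g $ i\<bar> * infnorm y"
      by (intro mult_left_mono component_le_infnorm_cart) auto
    finally show ?thesis .
  qed
  show ?thesis
  proof
    assume "g \<in> subdifferential infnorm x"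
    then have sub: "infnorm y \<ge> infnorm x + g \<bullet> (y - x)" for y
      by (simp add: subdifferential_def)
    \<comment> \<open>The test point 0 gives one inequality, the test point 2x the other.\<close>
    have eq: "g \<bullet> x = infnorm x"
      using sub[of 0] sub[of "2 *\<^sub>R x"]
      by (simp add: infnorm_0 infnorm_mul inner_diff_right)
    \<comment> \<open>The sign vector has norm at most 1 and turns the pairing with \<open>g\<close>
      into its l1 norm.\<close>
    define y :: "real ^ 'n" where "y = (\<chi> i. sgn (g $ i))"
    obtain k where "\<bar>y $ k\<bar> = infnorm y" by (rule infnorm_attained)
    then have "infnorm y \<le> 1" by (auto simp: y_def sgn_if split: if_splits)
    moreover have "g \<bullet> y = (\<Sum>i\<in>UNIV. \<bar>g $ i\<bar>)"
      by (simp add: inner_vec_def y_def abs_sgn)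
    ultimately have le1: "(\<Sum>i\<in>UNIV. \<bar>g $ i\<bar>) \<le> 1"
      using sub[of y] eq by (simp add: inner_diff_right)
    have ex: "(\<Sum>i\<in>UNIV. g $ i * x $ i) = infnorm x"
      using eq by (simp add: inner_vec_def)
    have "infnorm x \<le> (\<Sum>i\<in>UNIV. \<bar>g $ i\<bar> * infnorm x)"
      unfolding ex[symmetric] by (intro sum_mono) (simp add: ex le)
    then have "1 \<le> (\<Sum>i\<in>UNIV. \<bar>g $ i\<bar>)"
      using pos by (simp flip: sum_distrib_right)
    with le1 have sum1: "(\<Sum>i\<in>UNIV. \<bar>g $ i\<bar>) = 1" by simp
    \<comment> \<open>The Hoelder gaps are nonnegative by \<open>le\<close> and sum to zero, so each
      of them vanishes.\<close>
    then have "(\<Sum>i\<in>UNIV. \<bar>g $ i\<bar> * infnorm x - g $ i * x $ i) = 0"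
      by (simp add: sum_subtractf ex flip: sum_distrib_right)
    then have "\<forall>i. \<bar>g $ i\<bar> * infnorm x - g $ i * x $ i = 0"
      using le[of _ x] by (subst (asm) sum_nonneg_eq_0_iff) auto
    with sum1 show "(\<Sum>i\<in>UNIV. \<bar>g $ i\<bar>) = 1 \<and> (\<forall>i. g $ i * x $ i = \<bar>g $ i\<bar> * infnorm x)"
      by simp
  next
    assume g: "(\<Sum>i\<in>UNIV. \<bar>g $ i\<bar>) = 1 \<and> (\<forall>i. g $ i * x $ i = \<bar>g $ i\<bar> * infnorm x)"
    then have "g \<bullet> x = infnorm x"
      by (simp add: inner_vec_def flip: sum_distrib_right)
    moreover have "g \<bullet> y \<le> infnorm y" for y
    proof -
      have "g \<bullet> y \<le> (\<Sum>i\<in>UNIV. \<bar>g $ i\<bar> * infnorm y)"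
        by (simp add: inner_vec_def sum_mono le)
      then show ?thesis using g by (simp flip: sum_distrib_right)
    qed
    ultimately show "g \<in> subdifferential infnorm x"
      by (simp add: subdifferential_def inner_diff_right)
  qed
qed

text \<open>Exposes the edge variables \<open>z\<close> and the subgradient \<open>g\<close> as
  explicit witnesses, so that the same pair can later be reused at a different vector.\<close>

lemma eigenpair_iff:
  "eigenpair E \<mu> x \<longleftrightarrow> x \<noteq> 0 \<and> (\<exists>z g.
    (\<forall>i j. {i, j} \<in> E \<longrightarrow> z i j \<in> Sgn (x $ i - x $ j) \<and> z i j = - z j i) \<and>
    (\<Sum>i\<in>UNIV. \<bar>g i\<bar>) = 1 \<and> (\<forall>i. g i * x $ i = \<bar>g i\<bar> * infnorm x) \<and>
    (\<forall>i. (\<Sum>j\<in>neighbours E i. z i j) = \<mu> * real (vol E UNIV) * g i))"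
  (is "_ \<longleftrightarrow> x \<noteq> 0 \<and> (\<exists>z g. ?P z g)")
proof (cases "x = 0")
  case False
  have "(\<exists>z g. ?P z g) \<longleftrightarrow> one_laplacian E x \<inter>
      (\<lambda>v. (\<mu> * real (vol E UNIV)) *\<^sub>R v) ` subdifferential infnorm x \<noteq> {}" (is "?L \<longleftrightarrow> ?R")
  proof
    assume ?L
    then obtain z g where P: "?P z g" by blast
    have "(\<chi> i. g i) \<in> subdifferential infnorm x"
      using P False by (simp add: mem_subdifferential_infnorm_iff)
    moreover have "(\<mu> * real (vol E UNIV)) *\<^sub>R (\<chi> i. g i) \<in> one_laplacian E x"
      unfolding one_laplacian_def using P by (auto simp: vec_eq_iff intro!: exI[of _ z])
    ultimately show ?R by blast
  next
    assume ?R
    then obtain v where "v \<in> one_laplacian E x"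
      and "v \<in> (\<lambda>v. (\<mu> * real (vol E UNIV)) *\<^sub>R v) ` subdifferential infnorm x"
      by blast
    then obtain z g where g: "g \<in> subdifferential infnorm x"
      and z: "\<forall>i j. {i, j} \<in> E \<longrightarrow> z i j \<in> Sgn (x $ i - x $ j) \<and> z i j = - z j i"
      and u: "(\<chi> i. \<Sum>j\<in>neighbours E i. z i j) = (\<mu> * real (vol E UNIV)) *\<^sub>R g"
      unfolding one_laplacian_def by blast
    from u have "\<forall>i. (\<Sum>j\<in>neighbours E i. z i j) = \<mu> * real (vol E UNIV) * g $ i"
      by (simp add: vec_eq_iff)
    with g z show ?L
      unfolding mem_subdifferential_infnorm_iff[OF False] by blast
  qed
  then show ?thesis by (simp add: eigenpair_def False)
qed (simp add: eigenpair_def)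

section \<open>Double counting of edges\<close>

lemma mem_neighbours_iff: "j \<in> neighbours E i \<longleftrightarrow> {i, j} \<in> E"
  by (simp add: neighbours_def)

lemma sum_neighbours_swap:
  fixes f :: "'v::finite \<Rightarrow> 'v \<Rightarrow> 'a::comm_monoid_add"
  shows "(\<Sum>i\<in>A. \<Sum>j\<in>neighbours E i \<inter> B. f i j) = (\<Sum>j\<in>B. \<Sum>i\<in>neighbours E j \<inter> A. f i j)"
proof -
  have "(\<Sum>i\<in>A. \<Sum>j\<in>neighbours E i \<inter> B. f i j) = (\<Sum>i\<in>A. \<Sum>j | j \<in> B \<and> {i, j} \<in> E. f i j)"
    by (intro sum.cong) (auto simp: neighbours_def)
  also have "\<dots> = (\<Sum>j\<in>B. \<Sum>i | i \<in> A \<and> {i, j} \<in> E. f i j)"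
    by (rule sum.swap_restrict) auto
  also have "\<dots> = (\<Sum>j\<in>B. \<Sum>i\<in>neighbours E j \<inter> A. f i j)"
    by (intro sum.cong) (auto simp: neighbours_def insert_commute)
  finally show ?thesis .
qed

text \<open>Exchanging the two summations and applying antisymmetry turns the sum into its own
  negative.\<close>

lemma sum_neighbours_antisym:
  fixes z :: "'v::finite \<Rightarrow> 'v \<Rightarrow> real"
  assumes "\<And>i j. {i, j} \<in> E \<Longrightarrow> z i j = - z j i"
  shows "(\<Sum>i\<in>A. \<Sum>j\<in>neighbours E i \<inter> A. z i j) = 0"
proof -
  have "(\<Sum>i\<in>A. \<Sum>j\<in>neighbours E i \<inter> A. z i j) = (\<Sum>i\<in>A. \<Sum>j\<in>neighbours E i \<inter> A. - z i j)"
    by (subst sum_neighbours_swap, intro sum.cong refl, rule assms)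
      (auto simp: neighbours_def insert_commute)
  then show ?thesis by (simp add: sum_negf)
qed

text \<open>Weighted handshake identity: the neighbours of a fixed \<open>i\<close> correspond
  bijectively to the edges through \<open>i\<close>, and each edge is met once from each of its two
  endpoints.\<close>

lemma sum_neighbours_eq_sum_edges:
  fixes f :: "'v::finite set \<Rightarrow> real"
  assumes "simple_graph E"
  shows "(\<Sum>i\<in>UNIV. \<Sum>j\<in>neighbours E i. f {i, j}) = 2 * (\<Sum>e\<in>E. f e)"
proof -
  have "(\<Sum>j\<in>neighbours E i. f {i, j}) = (\<Sum>e | e \<in> E \<and> i \<in> e. f e)" for i
  proof (rule sum.reindex_bij_betw)
    have "e \<in> (\<lambda>j. {i, j}) ` neighbours E i" if "e \<in> E" "i \<in> e" for e
    proof -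
      obtain k l where "e = {k, l}"
        using \<open>e \<in> E\<close> assms by (metis simple_graph_def card_2_iff)
      with \<open>i \<in> e\<close> obtain j where "e = {i, j}" by (auto simp: insert_commute)
      with \<open>e \<in> E\<close> show ?thesis by (auto simp: neighbours_def)
    qed
    then show "bij_betw (\<lambda>j. {i, j}) (neighbours E i) {e. e \<in> E \<and> i \<in> e}"
      by (auto simp: bij_betw_def inj_on_def doubleton_eq_iff neighbours_def)
  qed
  then have "(\<Sum>i\<in>UNIV. \<Sum>j\<in>neighbours E i. f {i, j}) = (\<Sum>i\<in>UNIV. \<Sum>e | e \<in> E \<and> i \<in> e. f e)"
    by simp
  also have "\<dots> = (\<Sum>e\<in>E. \<Sum>i | i \<in> UNIV \<and> i \<in> e. f e)"
    by (rule sum.swap_restrict) auto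
  also have "\<dots> = (\<Sum>e\<in>E. 2 * f e)"
    using assms by (intro sum.cong) (auto simp: simple_graph_def)
  finally show ?thesis by (simp add: sum_distrib_left)
qed

lemma vol_UNIV_eq:
  assumes "simple_graph E"
  shows "real (vol E UNIV) = 2 * real (card E)"
  using sum_neighbours_eq_sum_edges[OF assms, of "\<lambda>_. 1"] by (simp add: vol_def degree_def)

text \<open>A boundary edge has exactly one endpoint in \<open>A\<close>, so orienting it outwards
  is a bijection with ordered pairs.\<close>

lemma card_edge_boundary_eq:
  fixes E :: "'v::finite set set"
  shows "card (edge_boundary E A) = (\<Sum>i\<in>A. card (neighbours E i \<inter> - A))"
proof -
  have "bij_betw (\<lambda>(i, j). {i, j}) (SIGMA i:A. neighbours E i \<inter> - A) (edge_boundary E A)"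
    by (auto simp: bij_betw_def inj_on_def doubleton_eq_iff edge_boundary_def neighbours_def
        image_iff)
  then show ?thesis by (simp add: bij_betw_same_card[symmetric])
qed

lemma edge_boundary_Compl: "edge_boundary E (- A) = edge_boundary E A"
  by (auto simp: edge_boundary_def insert_commute)

text \<open>A discrete divergence theorem: the flow \<open>z\<close> cancels inside
  \<open>A\<close>, and only the constant outflow \<open>c\<close> over the boundary
  survives.\<close>

lemma sum_neighbours_eq_boundary:
  fixes z :: "'v::finite \<Rightarrow> 'v \<Rightarrow> real"
  assumes anti: "\<And>i j. {i, j} \<in> E \<Longrightarrow> z i j = - z j i"
    and out: "\<And>i j. {i, j} \<in> E \<Longrightarrow> i \<in> A \<Longrightarrow> j \<notin> A \<Longrightarrow> z i j = c"
  shows "(\<Sum>i\<in>A. \<Sum>j\<in>neighbours E i. z i j) = c * real (card (edge_boundary E A))"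
proof -
  have "(\<Sum>j\<in>neighbours E i. z i j) =
      (\<Sum>j\<in>neighbours E i \<inter> A. z i j) + (\<Sum>j\<in>neighbours E i \<inter> - A. z i j)" for i
    by (subst sum.union_disjoint[symmetric]) (auto intro: sum.cong)
  then have "(\<Sum>i\<in>A. \<Sum>j\<in>neighbours E i. z i j) =
      (\<Sum>i\<in>A. \<Sum>j\<in>neighbours E i \<inter> A. z i j) + (\<Sum>i\<in>A. \<Sum>j\<in>neighbours E i \<inter> - A. z i j)"
    by (simp add: sum.distrib)
  also have "(\<Sum>i\<in>A. \<Sum>j\<in>neighbours E i \<inter> A. z i j) = 0"
    using anti by (rule sum_neighbours_antisym)
  also have "(\<Sum>i\<in>A. \<Sum>j\<in>neighbours E i \<inter> - A. z i j) = (\<Sum>i\<in>A. \<Sum>j\<in>neighbours E i \<inter> - A. c)"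
    by (intro sum.cong refl out) (auto simp: neighbours_def)
  finally show ?thesis
    by (simp add: card_edge_boundary_eq sum_distrib_left mult.commute)
qed

text \<open>Summation by parts: averaging over the two orientations of an edge replaces
  \<open>x $ i\<close> by half the difference across the edge, on which \<open>z i j\<close> acts as
  the sign.\<close>

lemma sum_laplacian_eq_total_variation:
  fixes x :: "real ^ 'v::finite"
  assumes "simple_graph E"
    and z: "\<And>i j. {i, j} \<in> E \<Longrightarrow> z i j \<in> Sgn (x $ i - x $ j) \<and> z i j = - z j i"
  shows "(\<Sum>i\<in>UNIV. (\<Sum>j\<in>neighbours E i. z i j) * x $ i) = total_variation E x"
proof -
  let ?S = "\<lambda>f. \<Sum>i\<in>UNIV. \<Sum>j\<in>neighbours E i. f i j :: real"
  have "?S (\<lambda>i j. z i j * x $ i) = ?S (\<lambda>i j. z j i * x $ j)"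
    using sum_neighbours_swap[of "\<lambda>i j. z i j * x $ i" E UNIV UNIV] by simp
  also have "\<dots> = ?S (\<lambda>i j. - (z i j * x $ j))"
  proof (intro sum.cong refl)
    fix i j assume "j \<in> neighbours E i"
    then have "z j i = - z i j" using z by (metis insert_commute mem_neighbours_iff)
    then show "z j i * x $ j = - (z i j * x $ j)" by simp
  qed
  finally have "2 * ?S (\<lambda>i j. z i j * x $ i) = ?S (\<lambda>i j. z i j * (x $ i - x $ j))"
    by (simp add: sum.distrib sum_subtractf sum_negf right_diff_distrib)
  also have "\<dots> = ?S (\<lambda>i j. edge_diff x {i, j})"
  proof (intro sum.cong refl)
    fix i j assume "j \<in> neighbours E i"
    \<comment> \<open>Any element of \<open>Sgn t\<close> times t is the absolute value of t; at t =
      0 the choice within the interval is irrelevant.\<close>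
    then have "z i j \<in> Sgn (x $ i - x $ j)" using z by (metis mem_neighbours_iff)
    then show "z i j * (x $ i - x $ j) = edge_diff x {i, j}"
      by (auto simp: Sgn_def split: if_splits)
  qed
  also have "\<dots> = 2 * total_variation E x"
    unfolding total_variation_def by (rule sum_neighbours_eq_sum_edges[OF assms(1)])
  finally show ?thesis by (simp add: sum_distrib_right)
qed

text \<open>Each edge contributes at most twice the norm, and the volume is twice the number of
  edges. These bounds confine the eigenvalues to the unit interval.\<close>

lemma total_variation_bounds:
  fixes x :: "real ^ 'v::finite"
  assumes "simple_graph E"
  shows "0 \<le> total_variation E x" and "total_variation E x \<le> real (vol E UNIV) * infnorm x"
proof -
  have *: "0 \<le> edge_diff x e \<and> edge_diff x e \<le> 2 * infnorm x" if "e \<in> E" for e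
  proof -
    obtain i j where "e = {i, j}"
      using \<open>e \<in> E\<close> assms by (metis simple_graph_def card_2_iff)
    then show ?thesis
      using component_le_infnorm_cart[of x i] component_le_infnorm_cart[of x j] by auto
  qed
  show "0 \<le> total_variation E x"
    unfolding total_variation_def using * by (intro sum_nonneg) auto
  have "total_variation E x \<le> of_nat (card E) * (2 * infnorm x)"
    unfolding total_variation_def using * by (intro sum_bounded_above) auto
  then show "total_variation E x \<le> real (vol E UNIV) * infnorm x"
    by (simp add: vol_UNIV_eq[OF assms])
qed

section \<open>Eigenpairs\<close>

lemma eigenpair_total_variation:
  assumes "simple_graph E" and "eigenpair E \<mu> x"
  shows "\<mu> * real (vol E UNIV) * infnorm x = total_variation E x"
proof -
  obtain z g where "x \<noteq> 0"
    and "\<forall>i j. {i, j} \<in> E \<longrightarrow> z i j \<in> Sgn (x $ i - x $ j) \<and> z i j = - z j i"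
    and "(\<Sum>i\<in>UNIV. \<bar>g i\<bar>) = 1" and "\<forall>i. g i * x $ i = \<bar>g i\<bar> * infnorm x"
    and "\<forall>i. (\<Sum>j\<in>neighbours E i. z i j) = \<mu> * real (vol E UNIV) * g i"
    using assms(2) unfolding eigenpair_iff by blast
  then have z: "\<And>i j. {i, j} \<in> E \<Longrightarrow> z i j \<in> Sgn (x $ i - x $ j) \<and> z i j = - z j i"
    and g: "(\<Sum>i\<in>UNIV. \<bar>g i\<bar>) = 1" "\<And>i. g i * x $ i = \<bar>g i\<bar> * infnorm x"
    and u: "\<And>i. (\<Sum>j\<in>neighbours E i. z i j) = \<mu> * real (vol E UNIV) * g i"
    by blast+
  have "total_variation E x = (\<Sum>i\<in>UNIV. \<mu> * real (vol E UNIV) * (\<bar>g i\<bar> * infnorm x))"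
    using sum_laplacian_eq_total_variation[OF assms(1) z] by (simp add: u mult.assoc g(2))
  then show ?thesis
    by (simp add: g(1) mult.assoc flip: sum_distrib_left sum_distrib_right)
qed

lemma eigenpair_boundary:
  assumes "eigenpair E \<mu> x"
  shows "2 * real (card (edge_boundary E (D_plus x))) = \<mu> * real (vol E UNIV)"
    and "2 * real (card (edge_boundary E (D_minus x))) = \<mu> * real (vol E UNIV)"
proof -
  obtain z g where x: "x \<noteq> 0"
    and "\<forall>i j. {i, j} \<in> E \<longrightarrow> z i j \<in> Sgn (x $ i - x $ j) \<and> z i j = - z j i"
    and "(\<Sum>i\<in>UNIV. \<bar>g i\<bar>) = 1" and "\<forall>i. g i * x $ i = \<bar>g i\<bar> * infnorm x"
    and "\<forall>i. (\<Sum>j\<in>neighbours E i. z i j) = \<mu> * real (vol E UNIV) * g i"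
    using assms unfolding eigenpair_iff by blast
  then have z: "\<And>i j. {i, j} \<in> E \<Longrightarrow> z i j \<in> Sgn (x $ i - x $ j) \<and> z i j = - z j i"
    and g: "(\<Sum>i\<in>UNIV. \<bar>g i\<bar>) = 1" "\<And>i. g i * x $ i = \<bar>g i\<bar> * infnorm x"
    and u: "\<And>i. (\<Sum>j\<in>neighbours E i. z i j) = \<mu> * real (vol E UNIV) * g i"
    by blast+
  let ?c = "\<mu> * real (vol E UNIV)"
  have pos: "infnorm x > 0" using x by (simp add: infnorm_pos_lt)
  have bd: "\<bar>x $ i\<bar> \<le> infnorm x" for i by (rule component_le_infnorm_cart)
  have gp: "\<bar>g i\<bar> = g i" if "i \<in> D_plus x" for i
    using g(2)[of i] that pos by (simp add: D_plus_def)
  have gm: "\<bar>g i\<bar> = - g i" if "i \<in> D_minus x" for i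
  proof -
    have "x $ i = - infnorm x" using that by (simp add: D_minus_def)
    then have "\<bar>g i\<bar> * infnorm x = - g i * infnorm x" using g(2)[of i] by simp
    then show ?thesis using pos by (subst (asm) mult_cancel_right) simp
  qed
  \<comment> \<open>A nonzero \<open>g i\<close> forces the coordinate \<open>x $ i\<close> to
    attain the norm in absolute value.\<close>
  have g0: "g i = 0" if "i \<notin> D_plus x" "i \<notin> D_minus x" for i
  proof (rule ccontr)
    assume "g i \<noteq> 0"
    moreover have "\<bar>g i\<bar> * infnorm x \<le> \<bar>g i\<bar> * \<bar>x $ i\<bar>"
      by (metis g(2) abs_ge_self abs_mult)
    ultimately have "infnorm x \<le> \<bar>x $ i\<bar>" by simp
    then show False using that bd[of i] by (auto simp: D_plus_def D_minus_def)
  qed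
  have disj: "D_plus x \<inter> D_minus x = {}"
    using pos by (auto simp: D_plus_def D_minus_def)
  have split: "sum f UNIV = sum f (D_plus x) + sum f (D_minus x)"
    if "\<And>i. g i = 0 \<Longrightarrow> f i = 0" for f :: "'a \<Rightarrow> real"
  proof -
    have "sum f UNIV = sum f (D_plus x \<union> D_minus x)"
      by (rule sum.mono_neutral_right) (auto simp: that g0)
    then show ?thesis using disj by (simp add: sum.union_disjoint)
  qed
  have "(\<Sum>i\<in>D_plus x. \<Sum>j\<in>neighbours E i. z i j)
      = 1 * real (card (edge_boundary E (D_plus x)))"
  proof (rule sum_neighbours_eq_boundary)
    fix i j assume e: "{i, j} \<in> E" and "i \<in> D_plus x" "j \<notin> D_plus x"
    \<comment> \<open>The maximum is attained at \<open>i\<close> but not at \<open>j\<close>, so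
      the inequality is strict and \<open>Sgn\<close> leaves no choice for
      \<open>z i j\<close>.\<close>
    then have "x $ i > x $ j" using bd[of j] by (auto simp: D_plus_def)
    then show "z i j = 1" using z[OF e] by (auto simp: Sgn_def)
  qed (use z in blast)
  then have P: "?c * (\<Sum>i\<in>D_plus x. g i) = real (card (edge_boundary E (D_plus x)))"
    by (simp add: u sum_distrib_left)
  have "(\<Sum>i\<in>D_minus x. \<Sum>j\<in>neighbours E i. z i j)
      = (-1) * real (card (edge_boundary E (D_minus x)))"
  proof (rule sum_neighbours_eq_boundary)
    fix i j assume e: "{i, j} \<in> E" and "i \<in> D_minus x" "j \<notin> D_minus x"
    then have "x $ i < x $ j" using bd[of j] by (auto simp: D_minus_def)
    then show "z i j = -1" using z[OF e] by (auto simp: Sgn_def)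
  qed (use z in blast)
  then have M: "?c * (\<Sum>i\<in>D_minus x. g i) = - real (card (edge_boundary E (D_minus x)))"
    by (simp add: u sum_distrib_left)
  \<comment> \<open>Nothing leaves the whole vertex set, so the masses of \<open>g\<close> on the
    two extremal sets, scaled by \<open>?c\<close>, are opposite.\<close>
  have "(\<Sum>i\<in>UNIV. \<Sum>j\<in>neighbours E i \<inter> UNIV. z i j) = 0"
    using z by (intro sum_neighbours_antisym) blast
  then have "?c * (\<Sum>i\<in>UNIV. g i) = 0"
    by (simp add: u sum_distrib_left)
  then have bal: "?c * (\<Sum>i\<in>D_plus x. g i) + ?c * (\<Sum>i\<in>D_minus x. g i) = 0"
    by (simp add: split distrib_left)
  have "1 = (\<Sum>i\<in>D_plus x. g i) - (\<Sum>i\<in>D_minus x. g i)"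
    using split[of "\<lambda>i. \<bar>g i\<bar>"] g(1) by (simp add: gp gm sum_negf)
  \<comment> \<open>Keeping the products with \<open>?c\<close> intact makes \<open>P\<close>,
    \<open>M\<close>, \<open>bal\<close> and \<open>one\<close> linear in them, and avoids dividing
    by \<open>?c\<close>, which may be zero.\<close>
  then have "?c = ?c * ((\<Sum>i\<in>D_plus x. g i) - (\<Sum>i\<in>D_minus x. g i))"
    by simp
  then have one: "?c = ?c * (\<Sum>i\<in>D_plus x. g i) - ?c * (\<Sum>i\<in>D_minus x. g i)"
    by (simp only: right_diff_distrib)
  show "2 * real (card (edge_boundary E (D_plus x))) = ?c"
    and "2 * real (card (edge_boundary E (D_minus x))) = ?c"
    using P M bal one by linarith+
qed

text \<open>By \<open>ord\<close>, passing from \<open>x\<close> to \<open>y\<close> may create ties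
  but never reverses or creates a strict inequality; a new tie only enlarges the \<open>Sgn\<close>
  set, so \<open>z\<close> stays admissible. By \<open>ext\<close>, \<open>y\<close> has the sign of
  \<open>x\<close> wherever \<open>g\<close> is nonzero, so \<open>g\<close> stays a
  subgradient.\<close>

lemma eigenpair_transfer:
  assumes "eigenpair E \<mu> x" and "infnorm y = 1"
    and ord: "\<And>i j. y $ i > y $ j \<Longrightarrow> x $ i > x $ j"
    and ext: "\<And>i. \<bar>x $ i\<bar> = infnorm x \<Longrightarrow> y $ i = sgn (x $ i)"
  shows "eigenpair E \<mu> y"
proof -
  obtain z g where x: "x \<noteq> 0"
    and "\<forall>i j. {i, j} \<in> E \<longrightarrow> z i j \<in> Sgn (x $ i - x $ j) \<and> z i j = - z j i"
    and "(\<Sum>i\<in>UNIV. \<bar>g i\<bar>) = 1" and "\<forall>i. g i * x $ i = \<bar>g i\<bar> * infnorm x"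
    and "\<forall>i. (\<Sum>j\<in>neighbours E i. z i j) = \<mu> * real (vol E UNIV) * g i"
    using assms(1) unfolding eigenpair_iff by blast
  then have z: "\<And>i j. {i, j} \<in> E \<Longrightarrow> z i j \<in> Sgn (x $ i - x $ j) \<and> z i j = - z j i"
    and g: "(\<Sum>i\<in>UNIV. \<bar>g i\<bar>) = 1" "\<And>i. g i * x $ i = \<bar>g i\<bar> * infnorm x"
    and u: "\<And>i. (\<Sum>j\<in>neighbours E i. z i j) = \<mu> * real (vol E UNIV) * g i"
    by blast+
  have pos: "infnorm x > 0" using x by (simp add: infnorm_pos_lt)
  have "z i j \<in> Sgn (y $ i - y $ j)" if "{i, j} \<in> E" for i j
    using z[OF that] ord[of i j] ord[of j i]
    by (cases "x $ i" "x $ j" rule: linorder_cases; cases "y $ i" "y $ j" rule: linorder_cases)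
      (auto simp: Sgn_def)
  moreover have "g i * y $ i = \<bar>g i\<bar> * infnorm y" for i
  proof (cases "g i = 0")
    case False
    \<comment> \<open>Absolute values in the subgradient identity show that the coordinate is
      extremal, so that \<open>ext\<close> applies.\<close>
    have "\<bar>g i\<bar> * \<bar>x $ i\<bar> = \<bar>g i\<bar> * infnorm x"
      using arg_cong[OF g(2)[of i], of abs] pos by (simp add: abs_mult)
    with False have eq: "\<bar>x $ i\<bar> = infnorm x" by simp
    with g(2)[of i] pos have "g i * sgn (x $ i) = \<bar>g i\<bar>"
      by (auto simp: sgn_if abs_if split: if_splits)
    then show ?thesis using ext[OF eq] assms(2) by simp
  qed simp
  moreover have "y \<noteq> 0" using assms(2) by (auto simp: infnorm_0)
  ultimately show ?thesis
    unfolding eigenpair_iff using z g(1) u by blast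
qed

text \<open>Both vectors apply a nondecreasing step function to the coordinates of \<open>x\<close>,
  taking the extreme values to 1 and -1. The first sends everything strictly between to 0, the
  second to -1.\<close>

lemma eigenpair_D_plus_D_minus:
  assumes "eigenpair E \<mu> x"
  shows "eigenpair E \<mu> (indicator_vec (D_plus x) - indicator_vec (D_minus x))"
    and "eigenpair E \<mu> (indicator_vec (D_plus x) - indicator_vec (- D_plus x))"
proof -
  have pos: "infnorm x > 0"
    using assms by (simp add: eigenpair_def infnorm_pos_lt)
  have bd: "\<bar>x $ i\<bar> \<le> infnorm x" for i by (rule component_le_infnorm_cart)
  obtain k where k: "\<bar>x $ k\<bar> = infnorm x" by (rule infnorm_attained)
  show "eigenpair E \<mu> (indicator_vec (D_plus x) - indicator_vec (D_minus x))" (is "eigenpair E \<mu> ?y")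
  proof (rule eigenpair_transfer[OF assms])
    show "infnorm ?y = 1"
      using k pos
      by (intro infnorm_eq_1I[where k = k])
        (auto simp: indicator_vec_def indicator_def of_bool_def D_plus_def D_minus_def)
    show "x $ i > x $ j" if "?y $ i > ?y $ j" for i j
      using that bd[of i] bd[of j] pos
      by (auto simp: indicator_vec_def indicator_def of_bool_def D_plus_def D_minus_def split: if_splits)
    show "?y $ i = sgn (x $ i)" if "\<bar>x $ i\<bar> = infnorm x" for i
      using that pos
      by (auto simp: indicator_vec_def indicator_def of_bool_def D_plus_def D_minus_def sgn_if abs_if
          split: if_splits)
  qed
  show "eigenpair E \<mu> (indicator_vec (D_plus x) - indicator_vec (- D_plus x))" (is "eigenpair E \<mu> ?y")
  proof (rule eigenpair_transfer[OF assms])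
    show "infnorm ?y = 1"
      by (intro infnorm_eq_1I[where k = k]) (auto simp: indicator_vec_def indicator_def of_bool_def)
    show "x $ i > x $ j" if "?y $ i > ?y $ j" for i j
      using that bd[of i] bd[of j]
      by (auto simp: indicator_vec_def indicator_def of_bool_def D_plus_def split: if_splits)
    show "?y $ i = sgn (x $ i)" if "\<bar>x $ i\<bar> = infnorm x" for i
      using that pos
      by (auto simp: indicator_vec_def indicator_def of_bool_def D_plus_def sgn_if abs_if split: if_splits)
  qed
qed

text \<open>All coordinates of a vector with entries 1 and -1 are extremal, so a subgradient only
  needs the right signs and l1 norm 1. Normalising a Laplacian vector \<open>u\<close> with these
  signs provides one.\<close>

lemma eigenpair_cut:
  fixes E :: "'v::finite set set"
  assumes "vol E UNIV > 0"
  shows "eigenpair E (2 * real (card (edge_boundary E A)) / real (vol E UNIV))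
    (indicator_vec A - indicator_vec (- A))"
proof -
  define x :: "real ^ 'v" where "x = indicator_vec A - indicator_vec (- A)"
  let ?b = "real (card (edge_boundary E A))"
  have comp: "x $ i = (if i \<in> A then 1 else -1)" for i
    by (simp add: x_def indicator_vec_def indicator_def of_bool_def)
  have norm: "infnorm x = 1"
    by (rule infnorm_eq_1I) (auto simp: comp)
  then have nz: "x \<noteq> 0" by (auto simp: infnorm_0)
  \<comment> \<open>Half the difference is 1 or -1 across the cut, as \<open>Sgn\<close> demands,
    and selects 0 on edges within one side.\<close>
  define z :: "'v \<Rightarrow> 'v \<Rightarrow> real" where "z i j = (x $ i - x $ j) / 2" for i j
  define u where "u i = (\<Sum>j\<in>neighbours E i. z i j)" for i
  have z: "z i j \<in> Sgn (x $ i - x $ j) \<and> z i j = - z j i" for i j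
    by (simp add: z_def comp Sgn_def)
  have ux: "\<bar>u i\<bar> = u i * x $ i" for i
    by (cases "i \<in> A")
      (auto simp: u_def z_def comp intro!: abs_of_nonneg abs_of_nonpos sum_nonneg sum_nonpos)
  have "(\<Sum>i\<in>A. u i) = 1 * ?b"
    unfolding u_def by (rule sum_neighbours_eq_boundary) (auto simp: z_def comp)
  moreover have "(\<Sum>i\<in>-A. u i) = (-1) * real (card (edge_boundary E (- A)))"
    unfolding u_def by (rule sum_neighbours_eq_boundary) (auto simp: z_def comp)
  moreover have "(\<Sum>i\<in>UNIV. \<bar>u i\<bar>) = (\<Sum>i\<in>A. u i) - (\<Sum>i\<in>-A. u i)"
    using sum.union_disjoint[of A "- A" "\<lambda>i. \<bar>u i\<bar>"]
    by (simp add: ux comp sum_negf)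
  ultimately have su: "(\<Sum>i\<in>UNIV. \<bar>u i\<bar>) = 2 * ?b"
    by (simp add: edge_boundary_Compl)
  \<comment> \<open>If \<open>A\<close> has no boundary then \<open>u = 0\<close>, and any subgradient will do.\<close>
  obtain g where g: "(\<Sum>i\<in>UNIV. \<bar>g i\<bar>) = 1" "\<And>i. \<bar>g i\<bar> = g i * x $ i"
    "\<And>i. u i = 2 * ?b * g i"
  proof (cases "?b = 0")
    case True
    then have "u i = 0" for i
      using su by (simp add: sum_nonneg_eq_0_iff)
    \<comment> \<open>An arbitrary vertex; the signed unit vector there is a subgradient.\<close>
    moreover obtain k :: 'v where True by simp
    ultimately show thesis
      using True by (intro that[of "\<lambda>i. if i = k then x $ k else 0"])
        (auto simp: comp if_distrib[of abs] cong: if_cong)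
  next
    case False
    then show thesis
      using su ux
      by (intro that[of "\<lambda>i. u i / (2 * ?b)"]) (auto simp: abs_divide simp flip: sum_divide_distrib)
  qed
  have "(\<Sum>j\<in>neighbours E i. z i j)
      = 2 * ?b / real (vol E UNIV) * real (vol E UNIV) * g i" for i
    using assms g(3)[of i] by (simp add: u_def)
  then show ?thesis
    unfolding x_def[symmetric] eigenpair_iff norm mult_1_right
    using nz z g(1) g(2)[symmetric] by blast
qed

theorem theorem4p4:
  fixes E :: "'v::finite set set"
  assumes "simple_graph E" and "E \<noteq> {}"
  shows "(\<forall>\<mu>. eigenvalue E \<mu> \<longrightarrow> 0 \<le> \<mu> \<and> \<mu> \<le> 1) \<and>
    ((\<forall>\<mu> \<nu>. eigenvalue E \<mu> \<and> eigenvalue E \<nu> \<and> \<mu> \<noteq> \<nu> \<longrightarrow> \<bar>\<mu> - \<nu>\<bar> \<ge> 2 / real (vol E UNIV)) \<and>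
     finite {\<mu>. eigenvalue E \<mu>} \<and>
     real (card {\<mu>. eigenvalue E \<mu>}) \<le> real (vol E UNIV) / 2 + 1) \<and>
    (\<forall>A. eigenpair E (2 * real (card (edge_boundary E A)) / real (vol E UNIV))
            (indicator_vec A - indicator_vec (- A))) \<and>
    (\<forall>\<mu> x. eigenpair E \<mu> x \<longrightarrow>
       total_variation E x / (real (vol E UNIV) * infnorm x) = \<mu> \<and>
       \<mu> / 2 = real (card (edge_boundary E (D_minus x))) / real (vol E UNIV) \<and>
       \<mu> / 2 = real (card (edge_boundary E (D_plus x))) / real (vol E UNIV) \<and>
       eigenpair E \<mu> (indicator_vec (D_plus x) - indicator_vec (D_minus x)) \<and>
       eigenpair E \<mu> (indicator_vec (D_plus x) - indicator_vec (- D_plus x)))"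
proof -
  let ?v = "real (vol E UNIV)"
  have vol: "?v = 2 * real (card E)" by (rule vol_UNIV_eq[OF assms(1)])
  have v: "?v > 0" using assms(2) by (simp add: vol card_gt_0_iff)
  have tv: "total_variation E x / (?v * infnorm x) = \<mu>" and pos: "infnorm x > 0"
    if "eigenpair E \<mu> x" for \<mu> x
  proof -
    show "infnorm x > 0" using that by (simp add: eigenpair_def infnorm_pos_lt)
    then show "total_variation E x / (?v * infnorm x) = \<mu>"
      using v by (simp add: eigenpair_total_variation[OF assms(1) that, symmetric])
  qed
  have range: "0 \<le> \<mu> \<and> \<mu> \<le> 1" if ev: "eigenvalue E \<mu>" for \<mu>
  proof -
    obtain x where x: "eigenpair E \<mu> x" using ev by (auto simp: eigenvalue_def)
    show ?thesis
      using total_variation_bounds[OF assms(1), of x] pos[OF x] v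
      unfolding tv[OF x, symmetric] by simp
  qed
  \<comment> \<open>The integer is the number of boundary edges of \<open>D_plus x\<close>.
    Integrality gives the gap, and the bound on \<open>k\<close> gives the count.\<close>
  have int: "\<exists>k \<le> card E. \<mu> = 2 * real k / ?v" if ev: "eigenvalue E \<mu>" for \<mu>
  proof -
    obtain x where x: "eigenpair E \<mu> x" using ev by (auto simp: eigenvalue_def)
    let ?k = "card (edge_boundary E (D_plus x))"
    have "\<mu> = 2 * real ?k / ?v"
      using eigenpair_boundary(1)[OF x] v by simp
    moreover have "?k \<le> card E" by (rule card_mono) (auto simp: edge_boundary_def)
    ultimately show ?thesis by blast
  qed
  have gap: "\<bar>\<mu> - \<nu>\<bar> \<ge> 2 / ?v" if ev: "eigenvalue E \<mu>" "eigenvalue E \<nu>" and "\<mu> \<noteq> \<nu>" for \<mu> \<nu>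
  proof -
    obtain k l where kl: "\<mu> = 2 * real k / ?v" "\<nu> = 2 * real l / ?v"
      using int[OF ev(1)] int[OF ev(2)] by blast
    with \<open>\<mu> \<noteq> \<nu>\<close> have "k \<noteq> l" by auto
    then have "1 \<le> \<bar>real k - real l\<bar>" by linarith
    then have "2 / ?v * 1 \<le> 2 / ?v * \<bar>real k - real l\<bar>"
      using v by (intro mult_left_mono) auto
    also have "\<dots> = \<bar>2 / ?v * (real k - real l)\<bar>"
      using v by (simp only: abs_mult abs_of_pos divide_pos_pos zero_less_numeral)
    also have "2 / ?v * (real k - real l) = \<mu> - \<nu>"
      by (simp add: kl right_diff_distrib)
    finally show ?thesis by simp
  qed
  \<comment> \<open>The value k = 0 is included, which accounts for the extra 1 beyond half the
    volume.\<close>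
  have sub: "{\<mu>. eigenvalue E \<mu>} \<subseteq> (\<lambda>k. 2 * real k / ?v) ` {..card E}"
    using int by blast
  then have fin: "finite {\<mu>. eigenvalue E \<mu>}"
    by (rule finite_subset) simp
  have "card {\<mu>. eigenvalue E \<mu>} \<le> card E + 1"
    using surj_card_le[OF _ sub] by simp
  then have card: "real (card {\<mu>. eigenvalue E \<mu>}) \<le> ?v / 2 + 1"
    by (simp add: vol)
  have half: "\<mu> / 2 = real (card (edge_boundary E (D_minus x))) / ?v"
    "\<mu> / 2 = real (card (edge_boundary E (D_plus x))) / ?v" if "eigenpair E \<mu> x" for \<mu> x
    using eigenpair_boundary[OF that] v by (simp_all add: field_simps)
  have cut: "eigenpair E (2 * real (card (edge_boundary E A)) / ?v)
      (indicator_vec A - indicator_vec (- A))" for A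
    using v by (intro eigenpair_cut) simp
  show ?thesis
    by (intro conjI allI impI; (elim conjE)?;
      rule range[THEN conjunct1] range[THEN conjunct2] gap fin card cut tv half
        eigenpair_D_plus_D_minus; assumption)
qed

end
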